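(* Let $C=\{q\in\Delta_{\mathcal X}:\langle q,u_h\rangle=0\text{ for }h=1,2,\dots,r\}$, where $u_1,\dots,u_r\in\mathbb R^m$, and assume that $C$ has support $\mathcal X$. Let $\nu\in\Delta_{\mathcal X}$ and let $(\nu(\delta))_{\delta>0}$ be a family in $\Delta_{\mathcal X}$ such that $\nu(\delta)>0$ for every $\delta>0$ and $\lim_{\delta\searrow0}\nu(\delta)=\nu$. Further, assume that $\nu(\cdot)$ is continuously differentiable and that there is a constant $c>0$ such that, for every $i\in\mathcal X^p$ (and every $\delta>0$), $$|\vartheta_i'(\delta)|\le c\,\vartheta_i(\delta),\qquad\text{where}\quad \vartheta_i(\delta)=\frac{\nu_i(\delta)}{\sum_{j\in\mathcal X^p}\nu_j(\delta)}.$$ Then $\lim_{\delta\searrow0}\hat q_{\mathcal P}(\delta)$ exists and belongs to $S_{\mathcal P}$.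
   Context: $\mathcal X$ is a finite nonempty set with $m$ elements; $\mathbb R^m$ is identified with $\mathbb R^{\mathcal X}$. Relations and functions of vectors are componentwise, $\sum x$ is the sum of the coordinates, $\langle\cdot,\cdot\rangle$ the scalar product. $\Delta_{\mathcal X}=\{q\in\mathbb R^m: q\ge 0,\ \sum q=1\}$. Conventions: $\log 0=-\infty$, $0\cdot(-\infty)=0$. The support of $C$ is $\{i\in\mathcal X:\ q_i>0\text{ for some }q\in C\}$. The passive alphabet is $\mathcal X^p=\{i\in\mathcal X:\nu_i=0\}$. For $\eta\in\Delta_{\mathcal X}$ put $\ell_\eta(q)=-\langle\eta,\log q\rangle$ for $q\in\Delta_{\mathcal X}$. $S_{\mathcal P}=\{\hat q\in C:\ell_\nu(\hat q)=\inf_{q\in C}\ell_\nu(q)\}$ is the solution set of the primal problem. For $\delta>0$, $\hat q_{\mathcal P}(\delta)$ denotes the unique minimizer of $\ell_{\nu(\delta)}$ over $C$ (it exists and is unique because $\nu(\delta)>0$). *)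

theory Defs
  imports "HOL-Analysis.Analysis"
begin

definition prob_simplex :: "(real ^ 'n) set" where
  "prob_simplex = {q. (\<forall>i. 0 \<le> q $ i) \<and> (\<Sum>i\<in>UNIV. q $ i) = 1}"

definition elog :: "real \<Rightarrow> ereal" where
  "elog x = (if x = 0 then - \<infinity> else ereal (ln x))"

(* On ereal, 0 * (- \<infinity>) = 0, which is the convention wanted here.  For eta and q in
   prob_simplex no summand is \<infinity>, so the sum never involves \<infinity> + (- \<infinity>). *)
definition ell :: "real ^ 'n \<Rightarrow> real ^ 'n \<Rightarrow> ereal" where
  "ell \<eta> q = - (\<Sum>i\<in>UNIV. ereal (\<eta> $ i) * elog (q $ i))"

definition set_support :: "(real ^ 'n) set \<Rightarrow> 'n set" where
  "set_support C = {i. \<exists>q\<in>C. q $ i > 0}"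

definition primal_solutions :: "(real ^ 'n) set \<Rightarrow> real ^ 'n \<Rightarrow> (real ^ 'n) set" where
  "primal_solutions C \<eta> = {q \<in> C. ell \<eta> q = (INF q'\<in>C. ell \<eta> q')}"

(* Only meaningful when the minimizer exists and is unique, e.g. for compact convex C of
   full support in prob_simplex and eta with all coordinates positive. *)
definition primal_minimizer :: "(real ^ 'n) set \<Rightarrow> real ^ 'n \<Rightarrow> real ^ 'n" where
  "primal_minimizer C \<eta> = (THE q. q \<in> primal_solutions C \<eta>)"

definition passive_set :: "real ^ 'n \<Rightarrow> 'n set" where
  "passive_set \<nu> = {i. \<nu> $ i = 0}"

(* Meant for delta > 0 and a nonempty passive set, where the denominator is positive. *)
definition passive_ratio ::
  "real ^ 'n \<Rightarrow> (real \<Rightarrow> real ^ 'n) \<Rightarrow> 'n \<Rightarrow> real \<Rightarrow> real" where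
  "passive_ratio \<nu> \<nu>d i \<delta> = \<nu>d \<delta> $ i / (\<Sum>j\<in>passive_set \<nu>. \<nu>d \<delta> $ j)"

end

theory Submission
  imports Defs
begin

text \<open>The minimizers \<open>q(\<delta>)\<close> lie in the compact set \<open>C\<close>, so it suffices to show that they have only
  one cluster point as \<open>\<delta>\<close> decreases to \<open>0\<close>, and that this point solves the limiting problem.

  Every cluster point \<open>q0\<close> is a solution (\<open>limit_of_minimizers_in_primal_solutions\<close>): in the
  inequality between the objective at \<open>q(\<delta>)\<close> and at a fixed positive competitor, the passive
  terms of \<open>q(\<delta>)\<close> have a favourable sign and can be dropped, while the active weights stay away from
  \<open>0\<close> and so keep the active coordinates of \<open>q(\<delta>)\<close> away from \<open>0\<close>. By strict concavity
  of the logarithm, all solutions have the same active coordinates.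

  It remains to control the passive coordinates. Let \<open>L\<close> be the set of passive coordinates that are
  positive at some solution, and let \<open>x\<close> be a solution that is positive on \<open>L\<close>. Two solutions differ
  only on \<open>L\<close>: both vanish at the other passive coordinates. Hence \<open>q(\<delta>) + x - q0\<close> differs
  from \<open>q(\<delta>)\<close> only on \<open>L\<close>, where it tends to \<open>x > 0\<close> along the parameters that realize \<open>q0\<close>.
  It is therefore eventually nonnegative, and because \<open>C\<close> is cut out of the simplex
  by linear equations, it is then a competitor of \<open>q(\<delta>)\<close>. All terms outside \<open>L\<close> cancel in the
  comparison, including the active ones, whose speed of convergence is unknown. What is left can be divided by the
  total passive mass; in the limit \<open>q0\<close> is positive on \<open>L\<close> and
  \<open>\<Sum>i\<in>L. \<theta> i * ln (x $ i)\<close> is at most \<open>\<Sum>i\<in>L. \<theta> i * ln (q0 $ i)\<close>, where \<open>\<theta> i\<close> is the limit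
  of the passive ratio (\<open>limit_of_minimizers_compare\<close>). So \<open>q0\<close> maximizes a strictly concave function of
  the coordinates in \<open>L\<close>, which determines it uniquely.

  The derivative bound enters only through the ratios: it says that their logarithms are Lipschitz in
  \<open>\<delta>\<close>, so that the ratios converge to positive limits
  (\<open>tendsto_at_right_positive_of_log_derivative_bound\<close>).\<close>

section \<open>The log-likelihood functional in real terms\<close>

lemma ell_eq:
  fixes \<eta> q :: "real ^ 'n"
  assumes \<eta>: "\<And>i. 0 \<le> \<eta> $ i" and q: "\<And>i. 0 \<le> q $ i"
  shows "ell \<eta> q = (if \<forall>i. 0 < \<eta> $ i \<longrightarrow> 0 < q $ i
                     then ereal (- (\<Sum>i\<in>UNIV. \<eta> $ i * ln (q $ i))) else \<infinity>)"
proof (cases "\<forall>i. 0 < \<eta> $ i \<longrightarrow> 0 < q $ i")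
  case True
  have "ereal (\<eta> $ i) * elog (q $ i) = ereal (\<eta> $ i * ln (q $ i))" for i
    using True \<eta>[of i] q[of i] by (cases "\<eta> $ i = 0") (auto simp: elog_def less_le zero_ereal_def[symmetric])
  then show ?thesis
    using True by (simp add: ell_def)
next
  case False
  then obtain j where j: "0 < \<eta> $ j" "q $ j = 0"
    using q by (metis order_le_less)
  have ninf: "ereal (\<eta> $ i) * elog (q $ i) \<noteq> \<infinity>" for i
    using \<eta>[of i] by (cases "\<eta> $ i = 0") (auto simp: elog_def zero_ereal_def[symmetric])
  have "ereal (\<eta> $ j) * elog (q $ j) = - \<infinity>"
    using j by (simp add: elog_def)
  moreover have "(\<Sum>i\<in>UNIV - {j}. ereal (\<eta> $ i) * elog (q $ i)) \<noteq> \<infinity>"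
    using ninf by (simp add: sum_Pinfty)
  ultimately have "(\<Sum>i\<in>UNIV. ereal (\<eta> $ i) * elog (q $ i)) = - \<infinity>"
    by (subst sum.remove[of _ j]) auto
  with False show ?thesis
    by (auto simp: ell_def)
qed

text \<open>The positive member \<open>p\<close> of \<open>C\<close> has finite objective value, so no minimizer can have the
  value \<open>\<infinity>\<close>. This allows the rest of the argument to stay within the real numbers: summands of weight
  \<open>0\<close> vanish whatever \<open>ln\<close> returns at \<open>0\<close>.\<close>

lemma mem_primal_solutions_iff:
  fixes C :: "(real ^ 'n) set"
  assumes C: "C \<subseteq> prob_simplex" and p: "p \<in> C" "\<And>i. 0 < p $ i"
    and \<eta>: "\<eta> \<in> prob_simplex"
  shows "q \<in> primal_solutions C \<eta> \<longleftrightarrow>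
    q \<in> C \<and> (\<forall>i. 0 < \<eta> $ i \<longrightarrow> 0 < q $ i) \<and>
    (\<forall>q'\<in>C. (\<forall>i. 0 < \<eta> $ i \<longrightarrow> 0 < q' $ i) \<longrightarrow>
      (\<Sum>i\<in>UNIV. \<eta> $ i * ln (q' $ i)) \<le> (\<Sum>i\<in>UNIV. \<eta> $ i * ln (q $ i)))"
proof -
  have nonneg: "0 \<le> \<eta> $ i" "x \<in> C \<Longrightarrow> 0 \<le> x $ i" for x i
    using \<eta> C by (auto simp: prob_simplex_def)
  have e: "ell \<eta> x = (if \<forall>i. 0 < \<eta> $ i \<longrightarrow> 0 < x $ i
      then ereal (- (\<Sum>i\<in>UNIV. \<eta> $ i * ln (x $ i))) else \<infinity>)" if "x \<in> C" for x
    using nonneg that by (intro ell_eq)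
  have "q \<in> primal_solutions C \<eta> \<longleftrightarrow> q \<in> C \<and> (\<forall>q'\<in>C. ell \<eta> q \<le> ell \<eta> q')"
    by (auto simp: primal_solutions_def intro!: antisym INF_lower INF_greatest)
  also have "\<dots> \<longleftrightarrow> q \<in> C \<and> (\<forall>i. 0 < \<eta> $ i \<longrightarrow> 0 < q $ i) \<and>
    (\<forall>q'\<in>C. (\<forall>i. 0 < \<eta> $ i \<longrightarrow> 0 < q' $ i) \<longrightarrow>
      (\<Sum>i\<in>UNIV. \<eta> $ i * ln (q' $ i)) \<le> (\<Sum>i\<in>UNIV. \<eta> $ i * ln (q $ i)))" (is "?A \<longleftrightarrow> ?B")
  proof
    assume A: ?A
    then have "ell \<eta> q \<le> ell \<eta> p" using p by blast
    with A p(2) have pos: "\<forall>i. 0 < \<eta> $ i \<longrightarrow> 0 < q $ i"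
      by (simp add: e p(1) split: if_splits)
    have "(\<Sum>i\<in>UNIV. \<eta> $ i * ln (q' $ i)) \<le> (\<Sum>i\<in>UNIV. \<eta> $ i * ln (q $ i))"
      if "q' \<in> C" "\<forall>i. 0 < \<eta> $ i \<longrightarrow> 0 < q' $ i" for q'
    proof -
      have "ell \<eta> q \<le> ell \<eta> q'" using A that by blast
      then show ?thesis using A that pos by (simp add: e)
    qed
    with A pos show ?B by blast
  next
    assume ?B
    then show ?A by (auto simp: e)
  qed
  finally show ?thesis .
qed

section \<open>Strict concavity and passage to the limit\<close>

lemma ln_midpoint:
  fixes a b :: real
  assumes "0 < a" "0 < b"
  shows "ln a + ln b \<le> 2 * ln ((a + b) / 2)"
    and "a \<noteq> b \<Longrightarrow> ln a + ln b < 2 * ln ((a + b) / 2)"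
proof -
  have eq: "ln a + ln b = ln (a * b)" "2 * ln ((a + b) / 2) = ln (((a + b) / 2)\<^sup>2)"
    using assms by (simp_all add: ln_mult ln_realpow)
  have sq: "((a + b) / 2)\<^sup>2 - a * b = ((a - b) / 2)\<^sup>2"
    by (simp add: field_simps power2_eq_square)
  have "a * b \<le> ((a + b) / 2)\<^sup>2"
    using sq zero_le_power2[of "(a - b) / 2"] by linarith
  then show "ln a + ln b \<le> 2 * ln ((a + b) / 2)"
    using assms unfolding eq by (subst ln_le_cancel_iff) auto
  assume "a \<noteq> b"
  then have "0 < ((a - b) / 2)\<^sup>2" by simp
  then have "a * b < ((a + b) / 2)\<^sup>2" using sq by linarith
  then show "ln a + ln b < 2 * ln ((a + b) / 2)"
    using assms unfolding eq by (subst ln_less_cancel_iff) auto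
qed

text \<open>If \<open>a\<close> and \<open>b\<close> differed somewhere, strict concavity would place the value at their midpoint
  strictly above the average of their own values.\<close>

lemma weighted_ln_sum_maximizer_unique:
  fixes w a b :: "'i \<Rightarrow> real"
  assumes "finite I" and w: "\<And>i. i \<in> I \<Longrightarrow> 0 < w i"
    and a: "\<And>i. i \<in> I \<Longrightarrow> 0 < a i" and b: "\<And>i. i \<in> I \<Longrightarrow> 0 < b i"
    and le_a: "(\<Sum>i\<in>I. w i * ln ((a i + b i) / 2)) \<le> (\<Sum>i\<in>I. w i * ln (a i))"
    and le_b: "(\<Sum>i\<in>I. w i * ln ((a i + b i) / 2)) \<le> (\<Sum>i\<in>I. w i * ln (b i))"
    and "j \<in> I"
  shows "a j = b j"
proof (rule ccontr)
  assume ne: "a j \<noteq> b j"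
  have "(\<Sum>i\<in>I. w i * (ln (a i) + ln (b i))) < (\<Sum>i\<in>I. w i * (2 * ln ((a i + b i) / 2)))"
    using assms ne
    by (intro sum_strict_mono_ex1 ballI mult_left_mono bexI[of _ j] mult_strict_left_mono
          ln_midpoint) (auto intro: less_imp_le)
  also have "\<dots> = 2 * (\<Sum>i\<in>I. w i * ln ((a i + b i) / 2))"
    by (simp add: sum_distrib_left mult_ac)
  also have "\<dots> \<le> (\<Sum>i\<in>I. w i * (ln (a i) + ln (b i)))"
    using le_a le_b by (simp add: distrib_left sum.distrib)
  finally show False by simp
qed

text \<open>All summands are nonpositive because \<open>x n i\<close> is at most \<open>1\<close>. A lower bound on the sum is therefore a lower
  bound on each summand, and as the weights have positive limits, no \<open>x n i\<close> can approach \<open>0\<close>,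
  where the logarithm falls to \<open>-\<infinity>\<close>. After that the sum is continuous.\<close>

lemma ln_barrier_limit:
  fixes w x :: "'b \<Rightarrow> 'i \<Rightarrow> real"
  assumes "finite I" and F: "F \<noteq> bot"
    and x: "\<And>i. i \<in> I \<Longrightarrow> ((\<lambda>n. x n i) \<longlongrightarrow> x0 i) F"
    and x_pos: "\<And>n i. i \<in> I \<Longrightarrow> 0 < x n i" and x_le: "\<And>n i. i \<in> I \<Longrightarrow> x n i \<le> 1"
    and w: "\<And>i. i \<in> I \<Longrightarrow> ((\<lambda>n. w n i) \<longlongrightarrow> w0 i) F"
    and w_pos: "\<And>n i. i \<in> I \<Longrightarrow> 0 < w n i" and w0: "\<And>i. i \<in> I \<Longrightarrow> 0 < w0 i"
    and b: "(b \<longlongrightarrow> b0) F"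
    and le: "\<forall>\<^sub>F n in F. b n \<le> (\<Sum>i\<in>I. w n i * ln (x n i))"
  shows "(\<forall>i\<in>I. 0 < x0 i) \<and> b0 \<le> (\<Sum>i\<in>I. w0 i * ln (x0 i))"
proof
  show pos: "\<forall>i\<in>I. 0 < x0 i"
  proof
    fix j assume j: "j \<in> I"
    have "\<forall>\<^sub>F n in F. b n \<le> w n j * ln (x n j)"
      using le
    proof eventually_elim
      case (elim n)
      have "(\<Sum>i\<in>I - {j}. w n i * ln (x n i)) \<le> 0"
        using x_pos x_le w_pos
        by (intro sum_nonpos mult_nonneg_nonpos) (auto intro: less_imp_le)
      with elim show ?case
        using sum.remove[OF \<open>finite I\<close> j, of "\<lambda>i. w n i * ln (x n i)"] by linarith
    qed
    then have "\<forall>\<^sub>F n in F. exp (b n / w n j) \<le> x n j"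
    proof eventually_elim
      case (elim n)
      then have "b n / w n j \<le> ln (x n j)"
        using w_pos[OF j, of n] by (simp add: field_simps)
      then have "exp (b n / w n j) \<le> exp (ln (x n j))" by simp
      then show ?case using x_pos[OF j, of n] by simp
    qed
    moreover have "((\<lambda>n. exp (b n / w n j)) \<longlongrightarrow> exp (b0 / w0 j)) F"
      using w0[OF j] by (intro tendsto_intros b w j) auto
    ultimately have "exp (b0 / w0 j) \<le> x0 j"
      by (intro tendsto_le[OF F x[OF j]])
    then show "0 < x0 j" using exp_gt_zero less_le_trans by blast
  qed
  have "((\<lambda>n. \<Sum>i\<in>I. w n i * ln (x n i)) \<longlongrightarrow> (\<Sum>i\<in>I. w0 i * ln (x0 i))) F"
    using pos by (intro tendsto_intros w x) auto
  then show "b0 \<le> (\<Sum>i\<in>I. w0 i * ln (x0 i))"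
    using tendsto_le[OF F _ b le] by blast
qed

section \<open>Convex families of distributions\<close>

text \<open>Average over \<open>i\<close> of members that are positive at \<open>i\<close>, wherever such a member exists.\<close>

lemma exists_full_support:
  fixes D :: "(real ^ 'n) set"
  assumes "convex D" "D \<noteq> {}" and nonneg: "\<And>q i. q \<in> D \<Longrightarrow> 0 \<le> q $ i"
  obtains q where "q \<in> D" "\<And>i. i \<in> set_support D \<Longrightarrow> 0 < q $ i"
proof -
  obtain d where d: "d \<in> D" using assms by blast
  have "\<exists>p\<in>D. i \<in> set_support D \<longrightarrow> 0 < p $ i" for i
    using d by (auto simp: set_support_def)
  then obtain p where p: "\<And>i. p i \<in> D" "\<And>i. i \<in> set_support D \<Longrightarrow> 0 < p i $ i"
    by metis
  define m where "m = real CARD('n)"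
  have m: "0 < m" by (simp add: m_def)
  define q where "q = (\<Sum>i\<in>UNIV. (1 / m) *\<^sub>R p i)"
  have "q \<in> D"
    unfolding q_def using p m
    by (intro convex_sum \<open>convex D\<close>) (auto simp: m_def)
  moreover have "0 < q $ i" if "i \<in> set_support D" for i
  proof -
    have "0 < (1 / m) * p i $ i" using p that m by simp
    also have "\<dots> \<le> (\<Sum>j\<in>UNIV. (1 / m) * p j $ i)"
      using m nonneg p(1) by (intro member_le_sum) auto
    finally show ?thesis by (simp add: q_def)
  qed
  ultimately show ?thesis using that by blast
qed

lemma convex_prob_simplex: "convex (prob_simplex :: (real ^ 'n) set)"
  by (auto simp: convex_def prob_simplex_def sum.distrib simp flip: sum_distrib_left)

lemma compact_prob_simplex: "compact (prob_simplex :: (real ^ 'n) set)"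
proof -
  have "closed {q :: real ^ 'n. (\<forall>i. 0 \<le> q $ i) \<and> (\<Sum>i\<in>UNIV. q $ i) = 1}"
    by (intro closed_Collect_conj closed_Collect_all closed_Collect_le closed_Collect_eq
          continuous_intros)
  moreover have "norm q \<le> 1" if "q \<in> prob_simplex" for q :: "real ^ 'n"
    using norm_le_l1_cart[of q] that by (simp add: prob_simplex_def)
  ultimately show ?thesis
    by (auto simp: compact_eq_bounded_closed prob_simplex_def bounded_iff)
qed

lemma prob_simplex_le_1:
  fixes q :: "real ^ 'n"
  assumes "q \<in> prob_simplex"
  shows "q $ i \<le> 1"
  using assms member_le_sum[of i UNIV "\<lambda>j. q $ j"] by (simp add: prob_simplex_def)

lemma primal_solutions_eq_on_support:
  fixes C :: "(real ^ 'n) set"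
  assumes C: "C \<subseteq> prob_simplex" "convex C" and p: "p \<in> C" "\<And>i. 0 < p $ i"
    and \<eta>: "\<eta> \<in> prob_simplex"
    and q: "q \<in> primal_solutions C \<eta>" and q': "q' \<in> primal_solutions C \<eta>" and j: "0 < \<eta> $ j"
  shows "q $ j = q' $ j"
proof -
  note iff = mem_primal_solutions_iff[OF C(1) p \<eta>]
  define mid where "mid = (1/2) *\<^sub>R q + (1/2) *\<^sub>R q'"
  have mid_nth: "mid $ i = (q $ i + q' $ i) / 2" for i
    by (simp add: mid_def field_simps)
  have mid: "mid \<in> C" 
    unfolding mid_def using q q' by (intro convexD C) (auto simp: primal_solutions_def)
  have pos: "0 < q $ i" "0 < q' $ i" if "0 < \<eta> $ i" for i
    using q q' that iff by auto
  have mid_pos: "\<forall>i. 0 < \<eta> $ i \<longrightarrow> 0 < mid $ i"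
    using pos by (simp add: mid_nth add_pos_pos)
  have restr: "(\<Sum>i\<in>UNIV. \<eta> $ i * f i) = (\<Sum>i | 0 < \<eta> $ i. \<eta> $ i * f i)" for f :: "'n \<Rightarrow> real"
    using \<eta> by (intro sum.mono_neutral_right) (auto simp: prob_simplex_def less_le)
  have "(\<Sum>i\<in>UNIV. \<eta> $ i * ln (mid $ i)) \<le> (\<Sum>i\<in>UNIV. \<eta> $ i * ln (q $ i))"
       "(\<Sum>i\<in>UNIV. \<eta> $ i * ln (mid $ i)) \<le> (\<Sum>i\<in>UNIV. \<eta> $ i * ln (q' $ i))"
    using q q' mid mid_pos iff by auto
  then show ?thesis
    unfolding restr mid_nth using pos j
    by (intro weighted_ln_sum_maximizer_unique[where I = "{i. 0 < \<eta> $ i}" and w = "\<lambda>i. \<eta> $ i"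
          and a = "\<lambda>i. q $ i" and b = "\<lambda>i. q' $ i"]) auto
qed

text \<open>Instead of the extended-real objective, which is only lower semicontinuous, the product
  of the \<open>q $ i powr \<eta> $ i\<close> is maximized. For positive weights it is continuous on all of \<open>C\<close>, boundary
  included, and at positive points it is the exponential of the weighted sum of logarithms.\<close>

lemma primal_minimizer_in_primal_solutions:
  fixes C :: "(real ^ 'n) set"
  assumes C: "C \<subseteq> prob_simplex" "convex C" "compact C" and p: "p \<in> C" "\<And>i. 0 < p $ i"
    and \<eta>: "\<eta> \<in> prob_simplex" "\<And>i. 0 < \<eta> $ i"
  shows "primal_minimizer C \<eta> \<in> primal_solutions C \<eta>"
proof -
  note iff = mem_primal_solutions_iff[OF C(1) p \<eta>(1)]
  have nonneg: "0 \<le> q $ i" if "q \<in> C" for q i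
    using that C by (auto simp: prob_simplex_def)
  define P where "P q = (\<Prod>i\<in>UNIV. q $ i powr \<eta> $ i)" for q :: "real ^ 'n"
  have P_exp: "P q = exp (\<Sum>i\<in>UNIV. \<eta> $ i * ln (q $ i))" if "\<And>i. 0 < q $ i" for q
    by (simp add: P_def exp_sum powr_def) (metis (mono_tags, lifting) less_irrefl prod.cong that)
  have "continuous_on C P"
    unfolding P_def using nonneg \<eta>(2)
    by (intro continuous_intros continuous_on_powr') auto
  then obtain q where q: "q \<in> C" "\<And>q'. q' \<in> C \<Longrightarrow> P q' \<le> P q"
    using continuous_attains_sup[OF C(3)] p by blast
  have "0 < P q"
    using P_exp[of p] p q(2)[of p] by (metis exp_gt_zero less_le_trans)
  moreover have "P q = 0" if "q $ i = 0" for i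
    unfolding P_def using that by (intro prod_zero) (auto intro!: exI[of _ i])
  ultimately have "q $ i \<noteq> 0" for i
    by fastforce
  then have q_pos: "0 < q $ i" for i
    using nonneg[OF q(1), of i] by (simp add: less_le)
  have "q \<in> primal_solutions C \<eta>"
    using q q_pos \<eta>(2) by (auto simp: iff) (metis P_exp exp_le_cancel_iff)
  moreover have "q' = q" if "q' \<in> primal_solutions C \<eta>" for q'
    using primal_solutions_eq_on_support[OF C(1,2) p \<eta>(1) that \<open>q \<in> primal_solutions C \<eta>\<close> \<eta>(2)]
    by (simp add: vec_eq_iff)
  ultimately show ?thesis
    unfolding primal_minimizer_def by (rule theI)
qed

section \<open>Cluster points from the right\<close>

definition right_cluster_point :: "(real \<Rightarrow> 'a::metric_space) \<Rightarrow> 'a \<Rightarrow> bool" where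
  "right_cluster_point f l \<longleftrightarrow>
     (\<exists>X. (\<forall>n::nat. 0 < X n) \<and> X \<longlonglongrightarrow> 0 \<and> (\<lambda>n. f (X n)) \<longlonglongrightarrow> l)"

lemma right_cluster_point_exists:
  assumes "compact K" "\<And>n. f (X n) \<in> K" "\<And>n::nat. 0 < X n" "X \<longlonglongrightarrow> 0"
  obtains l s where "right_cluster_point f l" "strict_mono s" "(\<lambda>n. f (X (s n))) \<longlonglongrightarrow> l"
proof -
  obtain l s where s: "strict_mono (s :: nat \<Rightarrow> nat)" "((\<lambda>n. f (X n)) \<circ> s) \<longlonglongrightarrow> l"
    using assms(1,2) unfolding compact_def by meson
  have "(X \<circ> s) \<longlonglongrightarrow> 0"
    using LIMSEQ_subseq_LIMSEQ[OF assms(4) s(1)] .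
  then have "right_cluster_point f l"
    unfolding right_cluster_point_def using s(2) assms(3)
    by (intro exI[of _ "X \<circ> s"]) (auto simp: o_def)
  then show ?thesis using that s by (auto simp: o_def)
qed

lemma tendsto_at_right_if_unique_cluster_point:
  assumes "compact K" and K: "\<And>x. 0 < x \<Longrightarrow> f x \<in> K"
    and uniq: "\<And>a b. right_cluster_point f a \<Longrightarrow> right_cluster_point f b \<Longrightarrow> a = b"
  obtains l where "right_cluster_point f l" "(f \<longlongrightarrow> l) (at_right 0)"
proof -
  obtain l where l: "right_cluster_point f l"
    using right_cluster_point_exists[of K f "\<lambda>n. 1 / real (Suc n)"] assms(1) K LIMSEQ_inverse_real_of_nat
    by (auto simp: inverse_eq_divide)
  have "(f \<longlongrightarrow> l) (at_right 0)"
  proof (rule ccontr)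
    assume "\<not> ?thesis"
    then obtain e where e: "0 < e" "\<not> (\<forall>\<^sub>F x in at_right 0. dist (f x) l < e)"
      unfolding tendsto_iff by blast
    have "\<exists>x. 0 < x \<and> x < 1 / real (Suc n) \<and> e \<le> dist (f x) l" for n
    proof (rule ccontr)
      assume "\<nexists>x. 0 < x \<and> x < 1 / real (Suc n) \<and> e \<le> dist (f x) l"
      then have "\<forall>\<^sub>F x in at_right 0. dist (f x) l < e"
        unfolding eventually_at_right_field
        by (intro exI[of _ "1 / real (Suc n)"]) (auto simp: not_le)
      with e show False by blast
    qed
    then obtain X where X: "\<And>n. 0 < X n" "\<And>n. X n < 1 / real (Suc n)" "\<And>n. e \<le> dist (f (X n)) l"
      by metis
    have "X \<longlonglongrightarrow> 0"
      using X(1,2) LIMSEQ_inverse_real_of_nat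
      by (intro tendsto_sandwich[of "\<lambda>_. 0" X sequentially "\<lambda>n. inverse (real (Suc n))"]
            always_eventually allI less_imp_le) (auto simp: inverse_eq_divide)
    with X(1) obtain b s where b: "right_cluster_point f b" "(\<lambda>n. f (X (s n))) \<longlonglongrightarrow> b"
      by (rule right_cluster_point_exists[where f = f and X = X, OF \<open>compact K\<close> K[OF X(1)]])
    have "(\<lambda>n. dist (f (X (s n))) l) \<longlonglongrightarrow> dist b l"
      by (intro tendsto_intros b)
    then have "e \<le> dist b l"
      using X(3) by (intro tendsto_lowerbound[of _ "dist b l" sequentially]) auto
    with uniq[OF l b(1)] e(1) show False by simp
  qed
  with l that show ?thesis by blast
qed

section \<open>Limits of the passive ratios\<close>

text \<open>The logarithm of \<open>f\<close> has a derivative bounded by \<open>c\<close>, so it is Lipschitz and extends continuously to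
  \<open>0\<close>; exponentiating a finite limit gives a positive one.\<close>

lemma tendsto_at_right_positive_of_log_derivative_bound:
  fixes f :: "real \<Rightarrow> real"
  assumes pos: "\<And>x. 0 < x \<Longrightarrow> 0 < f x" and diff: "\<And>x. 0 < x \<Longrightarrow> f differentiable at x"
    and bound: "\<And>x. 0 < x \<Longrightarrow> \<bar>deriv f x\<bar> \<le> c * f x"
  obtains l where "0 < l" "(f \<longlongrightarrow> l) (at_right 0)"
proof -
  have der: "((\<lambda>x. ln (f x)) has_real_derivative deriv f x / f x) (at x within {0<..})"
    if "0 < x" for x
  proof -
    have "(f has_real_derivative deriv f x) (at x)"
      using diff[OF that] by (simp add: DERIV_deriv_iff_real_differentiable)
    then have "((\<lambda>x. ln (f x)) has_real_derivative deriv f x / f x) (at x)"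
      using pos[OF that] by (auto intro!: derivative_eq_intros)
    then show ?thesis by (rule has_field_derivative_at_within)
  qed
  have lip: "dist (ln (f x)) (ln (f y)) \<le> c * dist x y" if "0 < x" "0 < y" for x y
  proof -
    have "norm (ln (f x) - ln (f y)) \<le> c * norm (x - y)"
    proof (rule field_differentiable_bound[where S = "{0<..}"])
      show "((\<lambda>x. ln (f x)) has_real_derivative deriv f z / f z) (at z within {0<..})"
        if "z \<in> {0<..}" for z using der that by simp
      show "norm (deriv f z / f z) \<le> c" if "z \<in> {0<..}" for z
        using bound[of z] pos[of z] that by (simp add: abs_div field_simps)
    qed (use that in auto)
    then show ?thesis by (simp add: dist_norm)
  qed
  have "0 \<le> c" using bound[of 1] pos[of 1] by (smt (verit) zero_less_one mult_neg_pos)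
  then have "c-lipschitz_on {0<..} (\<lambda>x. ln (f x))"
    using lip by (intro lipschitz_onI) auto
  then have "uniformly_continuous_on {0<..} (\<lambda>x. ln (f x))"
    by (rule lipschitz_on_uniformly_continuous)
  then obtain l where "((\<lambda>x. ln (f x)) \<longlongrightarrow> l) (at_right 0)"
    using uniformly_continuous_on_extension_at_closure[of "{0<..}" "\<lambda>x. ln (f x)" 0] by auto
  then have "((\<lambda>x. exp (ln (f x))) \<longlongrightarrow> exp l) (at_right 0)"
    by (rule tendsto_exp)
  moreover have "\<forall>\<^sub>F x in at_right 0. exp (ln (f x)) = f x"
    using eventually_at_right_less[of 0] by eventually_elim (simp add: pos)
  ultimately have "(f \<longlongrightarrow> exp l) (at_right 0)"
    by (simp cong: tendsto_cong)
  then show ?thesis by (rule that[rotated]) simp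
qed

section \<open>Cluster points of the minimizers\<close>

text \<open>The barrier lemma is applied on the set of active coordinates with a positive competitor, whose
  objective converges even though the passive weights vanish in the limit. Competitors that are zero
  at passive coordinates are then reached by moving them slightly towards \<open>p\<close>.\<close>

lemma limit_of_minimizers_in_primal_solutions:
  fixes C :: "(real ^ 'n) set" and \<eta> q :: "nat \<Rightarrow> real ^ 'n"
  assumes C: "C \<subseteq> prob_simplex" "convex C" "compact C" and p: "p \<in> C" "\<And>i. 0 < p $ i"
    and \<nu>: "\<nu> \<in> prob_simplex"
    and \<eta>: "\<And>n. \<eta> n \<in> prob_simplex" "\<And>n i. 0 < \<eta> n $ i" "\<eta> \<longlonglongrightarrow> \<nu>"
    and q: "\<And>n. q n \<in> primal_solutions C (\<eta> n)" "q \<longlonglongrightarrow> q0"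
  shows "q0 \<in> primal_solutions C \<nu>"
proof -
  define A where "A = {i. 0 < \<nu> $ i}"
  have restr: "(\<Sum>i\<in>UNIV. \<nu> $ i * f i) = (\<Sum>i\<in>A. \<nu> $ i * f i)" for f :: "'n \<Rightarrow> real"
    unfolding A_def using \<nu> by (intro sum.mono_neutral_right) (auto simp: prob_simplex_def less_le)
  note iff = mem_primal_solutions_iff[OF C(1) p \<eta>(1)]
  have qn: "q n \<in> C" "0 < q n $ i" "q n $ i \<le> 1" for n i
    using q(1)[of n] iff \<eta>(2) C(1) prob_simplex_le_1[of "q n" i] by auto
  have "q0 \<in> C"
    using closed_sequentially[OF compact_imp_closed[OF C(3)]] qn(1) q(2) by blast
  have opt: "(\<forall>i\<in>A. 0 < q0 $ i) \<and>
      (\<Sum>i\<in>UNIV. \<nu> $ i * ln (x $ i)) \<le> (\<Sum>i\<in>A. \<nu> $ i * ln (q0 $ i))"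
    if x: "x \<in> C" "\<And>i. 0 < x $ i" for x
  proof (rule ln_barrier_limit[where F = sequentially and x = "\<lambda>n i. q n $ i" and w = "\<lambda>n i. \<eta> n $ i"
            and b = "\<lambda>n. \<Sum>i\<in>UNIV. \<eta> n $ i * ln (x $ i)"])
    show "\<forall>\<^sub>F n in sequentially.
        (\<Sum>i\<in>UNIV. \<eta> n $ i * ln (x $ i)) \<le> (\<Sum>i\<in>A. \<eta> n $ i * ln (q n $ i))"
    proof (intro always_eventually allI)
      fix n
      have "(\<Sum>i\<in>UNIV. \<eta> n $ i * ln (x $ i)) \<le> (\<Sum>i\<in>UNIV. \<eta> n $ i * ln (q n $ i))"
        using q(1)[of n] iff x by auto
      also have "\<dots> = (\<Sum>i\<in>A. \<eta> n $ i * ln (q n $ i)) + (\<Sum>i\<in>-A. \<eta> n $ i * ln (q n $ i))"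
        by (subst sum.union_disjoint[symmetric]) auto
      also have "(\<Sum>i\<in>-A. \<eta> n $ i * ln (q n $ i)) \<le> 0"
        using qn \<eta>(2) by (intro sum_nonpos mult_nonneg_nonpos) (auto intro: less_imp_le)
      finally show "(\<Sum>i\<in>UNIV. \<eta> n $ i * ln (x $ i)) \<le> (\<Sum>i\<in>A. \<eta> n $ i * ln (q n $ i))"
        by simp
    qed
  qed (use qn \<eta>(2) in \<open>auto simp: A_def intro!: tendsto_intros q(2) \<eta>(3)\<close>)
  have "(\<Sum>i\<in>UNIV. \<nu> $ i * ln (x $ i)) \<le> (\<Sum>i\<in>UNIV. \<nu> $ i * ln (q0 $ i))"
    if x: "x \<in> C" "\<forall>i. 0 < \<nu> $ i \<longrightarrow> 0 < x $ i" for x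
  proof -
    define y where "y t = (1 - t) *\<^sub>R x + t *\<^sub>R p" for t :: real
    have x_nonneg: "0 \<le> x $ i" for i using x(1) C(1) by (auto simp: prob_simplex_def)
    have le: "(\<Sum>i\<in>A. \<nu> $ i * ln (y t $ i)) \<le> (\<Sum>i\<in>A. \<nu> $ i * ln (q0 $ i))" if "0 < t" "t < 1" for t
    proof -
      have "y t \<in> C" unfolding y_def using that x p by (intro convexD C) auto
      moreover have "0 < y t $ i" for i
        using that x_nonneg[of i] p(2)[of i] by (simp add: y_def add_nonneg_pos)
      ultimately show ?thesis using opt restr by simp
    qed
    have ev: "\<forall>\<^sub>F t in at_right (0::real).
        (\<Sum>i\<in>A. \<nu> $ i * ln (y t $ i)) \<le> (\<Sum>i\<in>A. \<nu> $ i * ln (q0 $ i))"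
      unfolding eventually_at_right_field using le by (intro exI[of _ 1]) auto
    have "(y \<longlongrightarrow> (1 - 0) *\<^sub>R x + 0 *\<^sub>R p) (at_right 0)"
      unfolding y_def by (intro tendsto_intros)
    then have "(y \<longlongrightarrow> x) (at_right 0)" by simp
    then have "((\<lambda>t. \<Sum>i\<in>A. \<nu> $ i * ln (y t $ i)) \<longlongrightarrow> (\<Sum>i\<in>A. \<nu> $ i * ln (x $ i))) (at_right 0)"
      using x(2) by (intro tendsto_intros) (auto simp: A_def)
    then have "(\<Sum>i\<in>A. \<nu> $ i * ln (x $ i)) \<le> (\<Sum>i\<in>A. \<nu> $ i * ln (q0 $ i))"
      by (rule tendsto_le[OF trivial_limit_at_right_real tendsto_const _ ev])
    then show ?thesis by (simp add: restr)
  qed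
  then show ?thesis
    using \<open>q0 \<in> C\<close> opt[OF p]
    by (simp add: mem_primal_solutions_iff[OF C(1) p \<nu>] A_def)
qed

text \<open>The competitor of \<open>q n\<close> is \<open>q n + x - q0\<close>. Since it agrees with \<open>q n\<close> off \<open>L\<close>, only the weights on \<open>L\<close>
  enter the comparison, and these may be rescaled by \<open>\<rho> n\<close> to have positive limits even if they
  tend to \<open>0\<close>.\<close>

lemma limit_of_minimizers_compare:
  fixes C :: "(real ^ 'n) set" and \<eta> q :: "nat \<Rightarrow> real ^ 'n" and \<rho> :: "nat \<Rightarrow> real"
  assumes C: "C \<subseteq> prob_simplex" and p: "p \<in> C" "\<And>i. 0 < p $ i"
    and exchange: "\<And>a b d. a \<in> C \<Longrightarrow> b \<in> C \<Longrightarrow> d \<in> C \<Longrightarrow> (\<And>i. 0 \<le> (a + b - d) $ i) \<Longrightarrow> a + b - d \<in> C"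
    and \<eta>: "\<And>n. \<eta> n \<in> prob_simplex" "\<And>n i. 0 < \<eta> n $ i"
    and q: "\<And>n. q n \<in> primal_solutions C (\<eta> n)" "q \<longlonglongrightarrow> q0" "q0 \<in> C"
    and \<rho>: "\<And>n. 0 < \<rho> n"
    and \<theta>: "\<And>i. i \<in> L \<Longrightarrow> 0 < \<theta> i" "\<And>i. i \<in> L \<Longrightarrow> (\<lambda>n. \<eta> n $ i / \<rho> n) \<longlonglongrightarrow> \<theta> i"
    and x: "x \<in> C" "\<And>i. i \<in> L \<Longrightarrow> 0 < x $ i" "\<And>i. i \<notin> L \<Longrightarrow> x $ i = q0 $ i"
  shows "(\<forall>i\<in>L. 0 < q0 $ i) \<and> (\<Sum>i\<in>L. \<theta> i * ln (x $ i)) \<le> (\<Sum>i\<in>L. \<theta> i * ln (q0 $ i))"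
proof -
  note iff = mem_primal_solutions_iff[OF C p \<eta>(1)]
  have qn: "q n \<in> C" "0 < q n $ i" "q n $ i \<le> 1" for n i
    using q(1)[of n] iff \<eta>(2) C prob_simplex_le_1[of "q n" i] by auto
  define y where "y n = q n + x - q0" for n
  have y_off: "y n $ i = q n $ i" if "i \<notin> L" for n i
    using x(3)[OF that] by (simp add: y_def)
  have "y \<longlonglongrightarrow> q0 + x - q0"
    unfolding y_def by (intro tendsto_intros q)
  then have y_lim: "y \<longlonglongrightarrow> x" by simp
  have "\<forall>\<^sub>F n in sequentially. 0 < y n $ i" for i
  proof (cases "i \<in> L")
    case True
    then show ?thesis
      using order_tendstoD(1)[OF tendsto_vec_nth[OF y_lim]] x(2) by blast
  next
    case False
    then show ?thesis using y_off qn(2) by simp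
  qed
  then have ev: "\<forall>\<^sub>F n in sequentially. \<forall>i. 0 < y n $ i"
    by (simp add: eventually_all_finite)
  show ?thesis
  proof (rule ln_barrier_limit[where F = sequentially and x = "\<lambda>n i. q n $ i"
            and w = "\<lambda>n i. \<eta> n $ i / \<rho> n"
            and b = "\<lambda>n. \<Sum>i\<in>L. \<eta> n $ i / \<rho> n * ln (y n $ i)"])
    show "\<forall>\<^sub>F n in sequentially. (\<Sum>i\<in>L. \<eta> n $ i / \<rho> n * ln (y n $ i))
        \<le> (\<Sum>i\<in>L. \<eta> n $ i / \<rho> n * ln (q n $ i))"
      using ev
    proof eventually_elim
      case (elim n)
      have "y n \<in> C"
        unfolding y_def using elim
        by (intro exchange qn x q less_imp_le) (simp add: y_def)
      then have "(\<Sum>i\<in>UNIV. \<eta> n $ i * ln (y n $ i)) \<le> (\<Sum>i\<in>UNIV. \<eta> n $ i * ln (q n $ i))"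
        using q(1)[of n] elim iff by auto
      moreover have "(\<Sum>i\<in>UNIV. \<eta> n $ i * ln (z $ i)) =
          (\<Sum>i\<in>L. \<eta> n $ i * ln (z $ i)) + (\<Sum>i\<in>-L. \<eta> n $ i * ln (z $ i))" for z :: "real ^ 'n"
        by (subst sum.union_disjoint[symmetric]) auto
      ultimately have "(\<Sum>i\<in>L. \<eta> n $ i * ln (y n $ i)) \<le> (\<Sum>i\<in>L. \<eta> n $ i * ln (q n $ i))"
        using y_off by simp
      then have "(\<Sum>i\<in>L. \<eta> n $ i * ln (y n $ i)) / \<rho> n \<le> (\<Sum>i\<in>L. \<eta> n $ i * ln (q n $ i)) / \<rho> n"
        using \<rho>[of n] by (intro divide_right_mono) auto
      then show ?case by (simp add: sum_divide_distrib)
    qed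
    show "(\<lambda>n. \<Sum>i\<in>L. \<eta> n $ i / \<rho> n * ln (y n $ i)) \<longlonglongrightarrow> (\<Sum>i\<in>L. \<theta> i * ln (x $ i))"
    proof (intro tendsto_sum tendsto_mult tendsto_ln tendsto_vec_nth y_lim \<theta>(2))
      show "x $ i \<noteq> 0" if "i \<in> L" for i using x(2)[OF that] by simp
    qed
  qed (use qn \<eta>(2) \<rho> \<theta> in \<open>auto intro!: tendsto_vec_nth q(2)\<close>)
qed

section \<open>Convergence of the minimizers\<close>

theorem theorem21:
  fixes u :: "nat \<Rightarrow> real ^ 'n" and r :: nat
    and C :: "(real ^ 'n) set"
    and \<nu> :: "real ^ 'n" and \<nu>d :: "real \<Rightarrow> real ^ 'n"
    and c :: real
  assumes C_def: "C = {q \<in> prob_simplex. \<forall>h\<in>{1..r}. q \<bullet> u h = 0}"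
    and support: "set_support C = UNIV"
    and nu: "\<nu> \<in> prob_simplex"
    and nud_simplex: "\<And>\<delta>. \<delta> > 0 \<Longrightarrow> \<nu>d \<delta> \<in> prob_simplex"
    and nud_pos: "\<And>\<delta> i. \<delta> > 0 \<Longrightarrow> \<nu>d \<delta> $ i > 0"
    and nud_lim: "(\<nu>d \<longlongrightarrow> \<nu>) (at_right 0)"
    and nud_C1: "\<nu>d C1_differentiable_on {0<..}"
    and c_pos: "c > 0"
    and ratio_bound: "\<And>i \<delta>. i \<in> passive_set \<nu> \<Longrightarrow> \<delta> > 0 \<Longrightarrow>
        \<bar>deriv (passive_ratio \<nu> \<nu>d i) \<delta>\<bar> \<le> c * passive_ratio \<nu> \<nu>d i \<delta>"
  shows "\<exists>q \<in> primal_solutions C \<nu>.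
      ((\<lambda>\<delta>. primal_minimizer C (\<nu>d \<delta>)) \<longlongrightarrow> q) (at_right 0)"
proof -
  define Lin where "Lin = {q :: real ^ 'n. \<forall>h\<in>{1..r}. q \<bullet> u h = 0}"
  have C_Int: "C = prob_simplex \<inter> Lin" by (auto simp: C_def Lin_def)
  have "convex Lin" by (auto simp: convex_def Lin_def inner_add_left)
  have Lin_eq: "Lin = (\<Inter>h\<in>{1..r}. {q. q \<bullet> u h = 0})" by (auto simp: Lin_def)
  have "closed Lin"
    unfolding Lin_eq by (intro closed_INT ballI closed_Collect_eq continuous_intros)
  have C: "C \<subseteq> prob_simplex" "convex C" "compact C"
    unfolding C_Int using convex_prob_simplex compact_prob_simplex \<open>convex Lin\<close> \<open>closed Lin\<close>
    by (auto intro: convex_Int compact_Int_closed)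
  have nonneg: "0 \<le> q $ i" if "q \<in> C" for q i
    using that by (simp add: C_def prob_simplex_def)
  have "C \<noteq> {}" using support by (auto simp: set_support_def)
  then obtain p where p: "p \<in> C" "\<And>i. 0 < p $ i"
    using exists_full_support[OF C(2) \<open>C \<noteq> {}\<close> nonneg] support by (metis UNIV_I)
  have exchange: "a + b - d \<in> C"
    if "a \<in> C" "b \<in> C" "d \<in> C" "\<And>i. 0 \<le> (a + b - d) $ i" for a b d
    using that
    by (auto simp: C_def prob_simplex_def sum.distrib sum_subtractf inner_add_left inner_diff_left)

  define Q where "Q \<delta> = primal_minimizer C (\<nu>d \<delta>)" for \<delta>
  have Q: "Q \<delta> \<in> primal_solutions C (\<nu>d \<delta>)" if "0 < \<delta>" for \<delta>
    unfolding Q_def using that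
    by (intro primal_minimizer_in_primal_solutions[OF C p] nud_simplex nud_pos)
  have QC: "Q \<delta> \<in> C" if "0 < \<delta>" for \<delta>
    using Q[OF that] by (simp add: primal_solutions_def)

  define \<rho> where "\<rho> \<delta> = (\<Sum>j\<in>passive_set \<nu>. \<nu>d \<delta> $ j)" for \<delta>
  have \<rho>_pos: "0 < \<rho> \<delta>" if "0 < \<delta>" "passive_set \<nu> \<noteq> {}" for \<delta>
    unfolding \<rho>_def using that nud_pos by (intro sum_pos) auto
  have "\<exists>l>0. ((\<lambda>\<delta>. \<nu>d \<delta> $ i / \<rho> \<delta>) \<longlongrightarrow> l) (at_right 0)" if i: "i \<in> passive_set \<nu>" for i
  proof -
    have ratio: "passive_ratio \<nu> \<nu>d i = (\<lambda>\<delta>. \<nu>d \<delta> $ i / \<rho> \<delta>)"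
      by (simp add: passive_ratio_def \<rho>_def fun_eq_iff)
    have \<rho>_pos: "0 < \<rho> \<delta>" if "0 < \<delta>" for \<delta> using \<rho>_pos that i by blast
    have nth_diff: "(\<lambda>\<delta>. \<nu>d \<delta> $ j) differentiable at \<delta>" if "0 < \<delta>" for j \<delta>
    proof -
      have "\<nu>d differentiable at \<delta>"
        using nud_C1 that by (auto simp: C1_differentiable_on_eq)
      then show ?thesis
        unfolding differentiable_def by (blast intro: bounded_linear.has_derivative[OF bounded_linear_vec_nth])
    qed
    obtain l where "0 < l" "(passive_ratio \<nu> \<nu>d i \<longlongrightarrow> l) (at_right 0)"
    proof (rule tendsto_at_right_positive_of_log_derivative_bound)
      show "0 < passive_ratio \<nu> \<nu>d i \<delta>" if "0 < \<delta>" for \<delta>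
        using nud_pos \<rho>_pos that by (simp add: ratio)
      show "passive_ratio \<nu> \<nu>d i differentiable at \<delta>" if "0 < \<delta>" for \<delta>
      proof -
        have "\<rho> differentiable at \<delta>"
          unfolding \<rho>_def using nth_diff[OF that] by (intro differentiable_sum) auto
        then show ?thesis
          unfolding ratio using nth_diff[OF that] \<rho>_pos[OF that] by (intro differentiable_divide) auto
      qed
    qed (use ratio_bound i in blast)+
    then show ?thesis by (auto simp: ratio)
  qed
  then obtain \<theta> where \<theta>: "\<And>i. i \<in> passive_set \<nu> \<Longrightarrow> 0 < \<theta> i"
      "\<And>i. i \<in> passive_set \<nu> \<Longrightarrow> ((\<lambda>\<delta>. \<nu>d \<delta> $ i / \<rho> \<delta>) \<longlongrightarrow> \<theta> i) (at_right 0)"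
    by metis

  have at_right: "filterlim X (at_right 0) sequentially" if "\<forall>n. 0 < X n" "X \<longlonglongrightarrow> 0" for X :: "nat \<Rightarrow> real"
    using that by (auto simp: filterlim_at less_imp_neq[symmetric] intro!: always_eventually)
  have cluster: "a \<in> primal_solutions C \<nu>" if a: "right_cluster_point Q a" for a
  proof -
    obtain X where X: "\<forall>n. 0 < X n" "X \<longlonglongrightarrow> 0" "(\<lambda>n. Q (X n)) \<longlonglongrightarrow> a"
      using a by (auto simp: right_cluster_point_def)
    show ?thesis
      by (rule limit_of_minimizers_in_primal_solutions[OF C p nu, where \<eta> = "\<lambda>n. \<nu>d (X n)"
            and q = "\<lambda>n. Q (X n)"])
         (use X nud_simplex nud_pos Q filterlim_compose[OF nud_lim at_right] in auto)
  qed
  have unique: "a = b" if a: "right_cluster_point Q a" and b: "right_cluster_point Q b" for a b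
  proof -
    \<comment> \<open>This is the set of all solutions, described by their common active coordinates; in this form
      its convexity is immediate.\<close>
    define S where "S = {q \<in> C. \<forall>i. 0 < \<nu> $ i \<longrightarrow> q $ i = a $ i}"
    have aC: "a \<in> C" "b \<in> C"
      using cluster a b by (auto simp: primal_solutions_def)
    have S: "a \<in> S" "b \<in> S"
      using aC primal_solutions_eq_on_support[OF C(1,2) p nu cluster[OF b] cluster[OF a]]
      by (auto simp: S_def)
    have "S = C \<inter> {q. \<forall>i. 0 < \<nu> $ i \<longrightarrow> q $ i = a $ i}" by (auto simp: S_def)
    also have "convex \<dots>"
      by (intro convex_Int C) (auto simp: convex_def simp flip: distrib_right)
    finally have "convex S" .
    have S_C: "q \<in> C" if "q \<in> S" for q using that by (simp add: S_def)
    define L where "L = passive_set \<nu> \<inter> set_support S"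
    have "S \<noteq> {}" using S by blast
    then obtain x where x: "x \<in> S" "\<And>i. i \<in> set_support S \<Longrightarrow> 0 < x $ i"
      using exists_full_support[OF \<open>convex S\<close> _ nonneg[OF S_C]] by metis
    have agree: "z $ i = z' $ i" if "z \<in> S" "z' \<in> S" "i \<notin> L" for z z' i
    proof (cases "0 < \<nu> $ i")
      case True
      then show ?thesis using that by (simp add: S_def)
    next
      case False
      then have "i \<in> passive_set \<nu>"
        using nu by (auto simp: passive_set_def prob_simplex_def less_le)
      then have "i \<notin> set_support S" using that by (simp add: L_def)
      then have "z $ i \<le> 0" "z' $ i \<le> 0"
        using that(1,2) by (auto simp: set_support_def not_less)
      then show ?thesis
        using nonneg[OF S_C[OF that(1)], of i] nonneg[OF S_C[OF that(2)], of i] by simp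
    qed
    \<comment> \<open>\<open>L = {}\<close> is split off because the passive set may then be empty and \<open>\<rho>\<close> zero.\<close>
    have compare: "(\<forall>i\<in>L. 0 < q $ i) \<and> (\<Sum>i\<in>L. \<theta> i * ln (z $ i)) \<le> (\<Sum>i\<in>L. \<theta> i * ln (q $ i))"
      if q: "right_cluster_point Q q" "q \<in> S" and z: "z \<in> S" "\<And>i. i \<in> L \<Longrightarrow> 0 < z $ i" for q z
    proof (cases "L = {}")
      case False
      then have passive_ne: "passive_set \<nu> \<noteq> {}" by (auto simp: L_def)
      obtain X where X: "\<forall>n. 0 < X n" "X \<longlonglongrightarrow> 0" "(\<lambda>n. Q (X n)) \<longlonglongrightarrow> q"
        using q by (auto simp: right_cluster_point_def)
      show ?thesis
      proof (rule limit_of_minimizers_compare[OF C(1) p exchange, where \<eta> = "\<lambda>n. \<nu>d (X n)"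
            and q = "\<lambda>n. Q (X n)" and \<rho> = "\<lambda>n. \<rho> (X n)"])
        show "(\<lambda>n. \<nu>d (X n) $ i / \<rho> (X n)) \<longlonglongrightarrow> \<theta> i" if "i \<in> L" for i
          using filterlim_compose[OF \<theta>(2) at_right] that X by (simp add: L_def)
        show "z $ i = q $ i" if "i \<notin> L" for i
          using agree z q that by blast
      qed (use X nud_simplex nud_pos Q \<rho>_pos[OF _ passive_ne] \<theta>(1) q z S_C in \<open>auto simp: L_def\<close>)
    qed simp
    \<comment> \<open>Positivity of the cluster points on \<open>L\<close> comes from the comparison with \<open>x\<close>; only then can
      their midpoint serve as a common competitor.\<close>
    have pos: "0 < a $ i" "0 < b $ i" if "i \<in> L" for i
      using compare[OF a S(1) x(1)] compare[OF b S(2) x(1)] x(2) that by (auto simp: L_def)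
    define mid where "mid = (1/2) *\<^sub>R a + (1/2) *\<^sub>R b"
    have mid_nth: "mid $ i = (a $ i + b $ i) / 2" for i
      by (simp add: mid_def field_simps)
    have mid: "mid \<in> S"
      unfolding mid_def using S by (intro convexD \<open>convex S\<close>) auto
    have "0 < mid $ i" if "i \<in> L" for i
      using pos[OF that] by (simp add: mid_nth)
    then have "(\<Sum>i\<in>L. \<theta> i * ln (mid $ i)) \<le> (\<Sum>i\<in>L. \<theta> i * ln (a $ i))"
        "(\<Sum>i\<in>L. \<theta> i * ln (mid $ i)) \<le> (\<Sum>i\<in>L. \<theta> i * ln (b $ i))"
      using compare a b S mid by blast+
    then have "a $ i = b $ i" if "i \<in> L" for i
      unfolding mid_nth using pos \<theta>(1) that
      by (intro weighted_ln_sum_maximizer_unique[where I = L and w = \<theta>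
            and a = "\<lambda>i. a $ i" and b = "\<lambda>i. b $ i"]) (auto simp: L_def)
    then show ?thesis
      using agree[OF S] by (metis vec_eq_iff)
  qed
  obtain l where "right_cluster_point Q l" "(Q \<longlongrightarrow> l) (at_right 0)"
    by (rule tendsto_at_right_if_unique_cluster_point[where f = Q, OF C(3) QC unique])
  then show ?thesis
    using cluster unfolding Q_def by blast
qed

end
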